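(* Let $\Psi=(E,\Delta)$ be an ordered simplicial complex in the class QE. Then the lexicographic order on the set $\mathcal B$ of bases of $\Psi$ is a shelling order of $\Psi$. Moreover, under this shelling order the restriction set of every basis $B$ is its set of internally passive elements: $\mathcal R(B)=IP(B)$.
   Context: An ordered simplicial complex is a pair $\Psi=(E,\Delta)$ with $E$ a finite totally ordered set and $\Delta\subseteq 2^E$ a simplicial complex (closed under taking subsets, $\emptyset\in\Delta$). Elements of $\Delta$ are independent sets; inclusion-maximal ones are bases. $\Psi$ is pure if all bases have the same cardinality. The lexicographic order on subsets of $E$ is the dictionary order on increasingly sorted lists. QE: the class of $\Psi$ that are pure and such that for all bases $B_1,B_2$ and $b_1\in B_1\setminus B_2$ with $b_1>\max(B_2\setminus B_1)$, there is $b_2\in B_2\setminus B_1$ with $(B_1\setminus\{b_1\})\cup\{b_2\}\in\Delta$. A shelling order of a pure complex is an ordering $B_1,\dots,B_k$ of its bases such that for every $i<j$ there are $l<j$ and $b\in B_j$ with $B_i\cap B_j\subseteq B_l\cap B_j=B_j\setminus\{b\}$. For a shelling order, $\mathcal R(B_j)$ is the unique inclusion-minimal subset of $B_j$ not contained in any $B_i$ with $i<j$. For a basis $B$, an element $b\in B$ is internally active if $B$ is the lexicographically smallest basis containing $B\setminus\{b\}$, and internally passive otherwise; $IP(B)$ is the set of internally passive elements of $B$. *)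

theory Defs
  imports "HOL-Library.List_Lexorder"
begin

definition ordered_simplicial_complex :: "'a::linorder set \<Rightarrow> 'a set set \<Rightarrow> bool" where
  "ordered_simplicial_complex E \<Delta> \<longleftrightarrow>
     finite E \<and> \<Delta> \<subseteq> Pow E \<and> {} \<in> \<Delta> \<and> (\<forall>A\<in>\<Delta>. \<forall>B. B \<subseteq> A \<longrightarrow> B \<in> \<Delta>)"

definition bases :: "'a set set \<Rightarrow> 'a set set" where
  "bases \<Delta> = {B \<in> \<Delta>. \<forall>A\<in>\<Delta>. B \<subseteq> A \<longrightarrow> A = B}"

definition pure :: "'a set set \<Rightarrow> bool" where
  "pure \<Delta> \<longleftrightarrow> (\<forall>B\<^sub>1\<in>bases \<Delta>. \<forall>B\<^sub>2\<in>bases \<Delta>. card B\<^sub>1 = card B\<^sub>2)"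

text \<open>In a pure complex \<open>b\<^sub>1 \<in> B\<^sub>1 - B\<^sub>2\<close> forces \<open>B\<^sub>2 - B\<^sub>1\<close> to be nonempty, so
  \<open>Max\<close> is only taken of finite nonempty sets.\<close>
definition QE :: "'a::linorder set \<Rightarrow> 'a set set \<Rightarrow> bool" where
  "QE E \<Delta> \<longleftrightarrow> ordered_simplicial_complex E \<Delta> \<and> pure \<Delta> \<and>
     (\<forall>B\<^sub>1\<in>bases \<Delta>. \<forall>B\<^sub>2\<in>bases \<Delta>. \<forall>b\<^sub>1\<in>B\<^sub>1 - B\<^sub>2. b\<^sub>1 > Max (B\<^sub>2 - B\<^sub>1) \<longrightarrow>
        (\<exists>b\<^sub>2\<in>B\<^sub>2 - B\<^sub>1. (B\<^sub>1 - {b\<^sub>1}) \<union> {b\<^sub>2} \<in> \<Delta>))"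

text \<open>Here the order on lists is the dictionary order of \<open>List_Lexorder\<close>.\<close>
definition lex_le :: "'a::linorder set \<Rightarrow> 'a set \<Rightarrow> bool" where
  "lex_le A B \<longleftrightarrow> sorted_list_of_set A \<le> sorted_list_of_set B"

definition lex_order_bases :: "'a::linorder set set \<Rightarrow> 'a set list" where
  "lex_order_bases \<Delta> = map set (sorted_list_of_set (sorted_list_of_set ` bases \<Delta>))"

definition shelling_order :: "'a set set \<Rightarrow> 'a set list \<Rightarrow> bool" where
  "shelling_order \<Delta> Bs \<longleftrightarrow> pure \<Delta> \<and> distinct Bs \<and> set Bs = bases \<Delta> \<and>
     (\<forall>j<length Bs. \<forall>i<j. \<exists>l<j. \<exists>b\<in>Bs ! j.
        Bs ! i \<inter> Bs ! j \<subseteq> Bs ! l \<inter> Bs ! j \<and> Bs ! l \<inter> Bs ! j = Bs ! j - {b})"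

definition new_faces :: "'a set list \<Rightarrow> nat \<Rightarrow> 'a set set" where
  "new_faces Bs j = {S. S \<subseteq> Bs ! j \<and> (\<forall>i<j. \<not> S \<subseteq> Bs ! i)}"

text \<open>\<open>R\<close> is the restriction set \<open>\<R>(B\<^sub>j)\<close>: the one and only inclusion-minimal new face.
  A relation rather than a function, so that existence and uniqueness are part of it.\<close>
definition is_restriction_set :: "'a set list \<Rightarrow> nat \<Rightarrow> 'a set \<Rightarrow> bool" where
  "is_restriction_set Bs j R \<longleftrightarrow>
     {S \<in> new_faces Bs j. \<forall>T\<in>new_faces Bs j. T \<subseteq> S \<longrightarrow> T = S} = {R}"

definition internally_active :: "'a::linorder set set \<Rightarrow> 'a set \<Rightarrow> 'a \<Rightarrow> bool" where
  "internally_active \<Delta> B b \<longleftrightarrow> (\<forall>B'\<in>bases \<Delta>. B - {b} \<subseteq> B' \<longrightarrow> lex_le B B')"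

definition IP :: "'a::linorder set set \<Rightarrow> 'a set \<Rightarrow> 'a set" where
  "IP \<Delta> B = {b \<in> B. \<not> internally_active \<Delta> B b}"

text \<open>\<open>lex_order_bases\<close> lists exactly the bases, in strictly increasing lexicographic order.\<close>
lemma lex_order_bases_props:
  assumes "ordered_simplicial_complex E \<Delta>"
  shows "set (lex_order_bases \<Delta>) = bases \<Delta>"
    and "distinct (lex_order_bases \<Delta>)"
    and "sorted_wrt (\<lambda>A B. lex_le A B \<and> A \<noteq> B) (lex_order_bases \<Delta>)"
proof -
  let ?L = "sorted_list_of_set (sorted_list_of_set ` bases \<Delta>)"
  have sub: "bases \<Delta> \<subseteq> Pow E" and "finite E"
    using assms by (auto simp: ordered_simplicial_complex_def bases_def)
  then have finB: "finite B" if "B \<in> bases \<Delta>" for B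
    using that by (auto intro: finite_subset)
  have finb: "finite (bases \<Delta>)"
    using sub \<open>finite E\<close> by (meson finite_Pow_iff finite_subset)
  have setL: "set ?L = sorted_list_of_set ` bases \<Delta>"
    using finb by simp
  have inv: "sorted_list_of_set (set xs) = xs" if "xs \<in> set ?L" for xs
    using that finB unfolding setL by auto
  show "set (lex_order_bases \<Delta>) = bases \<Delta>"
    using finB unfolding lex_order_bases_def set_map setL image_image by simp
  have inj: "inj_on set (set ?L)"
    using inv by (metis inj_onI)
  then show d: "distinct (lex_order_bases \<Delta>)"
    unfolding lex_order_bases_def distinct_map by simp
  have "sorted_wrt (<) ?L" by simp
  then show "sorted_wrt (\<lambda>A B. lex_le A B \<and> A \<noteq> B) (lex_order_bases \<Delta>)"
    unfolding lex_order_bases_def sorted_wrt_map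
    by (rule sorted_wrt_mono_rel[rotated]) (auto simp: lex_le_def inv, metis inv less_irrefl)
qed

end

theory Submission
  imports Defs
begin

text \<open>The crux is that for bases \<open>A < B\<close> some \<open>b \<in> B - A\<close> is internally passive in \<open>B\<close>. If the
  largest element of the symmetric difference lies in \<open>B\<close>, exchanging it by QE for an element of
  \<open>A\<close> makes \<open>B\<close> smaller. Otherwise it lies in \<open>A\<close>, and exchanging it for an element of \<open>B\<close> gives
  a basis \<open>A'\<close> closer to \<open>B\<close> which is still smaller than \<open>B\<close>, because the least element of the
  symmetric difference, which decides the comparison, is untouched; so one can induct on
  \<open>card (A - B)\<close>. Hence \<open>IP(B)\<close> lies in no earlier basis, and it lies in every new face of \<open>B\<close>
  since \<open>B - {b}\<close> is an old face for every internally passive \<open>b\<close>.\<close>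

text \<open>Common minima can be stripped off until the heads differ, and then the heads decide.
  Equal cardinality excludes the case that \<open>B\<close> lists a proper prefix of
  \<open>A\<close>, which would reverse the comparison.\<close>

lemma sorted_list_of_set_less:
  fixes A B :: "'a::linorder set"
  assumes "finite A" "finite B" "card A = card B" "m \<in> A - B"
    and "\<And>x. x \<in> (A - B) \<union> (B - A) \<Longrightarrow> m \<le> x"
  shows "sorted_list_of_set A < sorted_list_of_set B"
  using assms
proof (induction "card A" arbitrary: A B)
  case 0
  then show ?case by auto
next
  case (Suc n)
  have ne: "A \<noteq> {}" "B \<noteq> {}" using Suc.hyps(2) Suc.prems(3) by auto
  note A = sorted_list_of_set_nonempty[OF Suc.prems(1) ne(1)]
  note B = sorted_list_of_set_nonempty[OF Suc.prems(2) ne(2)]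
  have mins: "Min A \<in> A" "Min B \<in> B" "Min A \<le> m"
    using ne Suc.prems by auto
  show ?case
  proof (cases "Min A = Min B")
    case True
    have "sorted_list_of_set (A - {Min A}) < sorted_list_of_set (B - {Min A})"
    proof (rule Suc.hyps(1))
      show "n = card (A - {Min A})"
        using Suc.hyps(2) Suc.prems(1) mins(1) by simp
      show "card (A - {Min A}) = card (B - {Min A})"
        using Suc.prems(3) mins True by simp
      show "m \<in> A - {Min A} - (B - {Min A})"
        using Suc.prems(4) mins True by auto
      show "m \<le> x"
        if "x \<in> A - {Min A} - (B - {Min A}) \<union> (B - {Min A} - (A - {Min A}))" for x
        using Suc.prems(5)[of x] that by blast
    qed (use Suc.prems in auto)
    then show ?thesis unfolding A B True by simp
  next
    case False
    \<comment> \<open>If \<open>Min B\<close> is not in \<open>A\<close>, it belongs to the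
      symmetric difference, so it is at least \<open>m\<close>, which is at least
      \<open>Min A\<close>.\<close>
    have "Min A \<le> Min B"
    proof (cases "Min B \<in> A")
      case True
      then show ?thesis using Suc.prems(1) by simp
    next
      case False
      then have "m \<le> Min B" using Suc.prems(5) mins(2) by blast
      then show ?thesis using mins(3) by simp
    qed
    then show ?thesis unfolding A B using False by simp
  qed
qed

text \<open>The witness is the least element of the symmetric difference: if it were in
  \<open>B - A\<close>, the previous lemma would give the opposite inequality.\<close>

lemma sorted_list_of_set_lessD:
  fixes A B :: "'a::linorder set"
  assumes "finite A" "finite B" "card A = card B"
    and "sorted_list_of_set A < sorted_list_of_set B"
  obtains m where "m \<in> A - B" "\<And>x. x \<in> (A - B) \<union> (B - A) \<Longrightarrow> m \<le> x"
proof -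
  let ?D = "(A - B) \<union> (B - A)"
  have D: "finite ?D" "?D \<noteq> {}" using assms by auto
  have min: "Min ?D \<in> ?D" "\<And>x. x \<in> ?D \<Longrightarrow> Min ?D \<le> x"
    using Min_in[OF D] Min_le[OF D(1)] by blast+
  have "Min ?D \<notin> B - A"
    using sorted_list_of_set_less[of B A "Min ?D"] assms min(2)
    by (metis Un_commute less_asym)
  with min that show thesis by blast
qed

lemma ordered_simplicial_complex_finite_face:
  assumes "ordered_simplicial_complex E \<Delta>" "A \<in> \<Delta>"
  shows "finite A"
  using assms unfolding ordered_simplicial_complex_def by (auto intro: finite_subset)

lemma face_subset_basis:
  assumes "ordered_simplicial_complex E \<Delta>" "A \<in> \<Delta>"
  obtains B where "B \<in> bases \<Delta>" "A \<subseteq> B"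
proof -
  have "finite \<Delta>"
    using assms(1) unfolding ordered_simplicial_complex_def
    by (meson finite_Pow_iff finite_subset)
  then obtain B where B: "B \<in> \<Delta>" "A \<subseteq> B" "\<forall>C\<in>\<Delta>. B \<subseteq> C \<longrightarrow> B = C"
    using finite_has_maximal2[OF _ assms(2)] by metis
  then have "B \<in> bases \<Delta>" by (auto simp: bases_def)
  then show thesis using B(2) by (rule that)
qed

lemma basis_if_card_eq:
  assumes "ordered_simplicial_complex E \<Delta>" "pure \<Delta>"
    and "A \<in> \<Delta>" "B \<in> bases \<Delta>" "card A = card B"
  shows "A \<in> bases \<Delta>"
proof -
  obtain C where C: "C \<in> bases \<Delta>" "A \<subseteq> C"
    using face_subset_basis[OF assms(1,3)] .
  then have "finite C"
    using ordered_simplicial_complex_finite_face[OF assms(1)] by (auto simp: bases_def)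
  moreover have "card A = card C" using assms(2,4,5) C(1) unfolding pure_def by metis
  ultimately show ?thesis using C card_subset_eq by metis
qed

text \<open>A form of the QE axiom without \<open>Max\<close>. The axiom itself yields only a face,
  but that face is as large as \<open>A\<close>, so purity makes it a basis.\<close>

lemma QE_exchange:
  assumes "QE E \<Delta>" "A \<in> bases \<Delta>" "B \<in> bases \<Delta>" "a \<in> A - B"
    and "\<And>x. x \<in> B - A \<Longrightarrow> x < a"
  obtains b where "b \<in> B - A" "insert b (A - {a}) \<in> bases \<Delta>"
proof -
  have osc: "ordered_simplicial_complex E \<Delta>" and pure: "pure \<Delta>"
    using assms(1) by (auto simp: QE_def)
  have fin: "finite A" "finite B"
    using assms(2,3) ordered_simplicial_complex_finite_face[OF osc] by (auto simp: bases_def)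
  have "card A = card B" using pure assms(2,3) unfolding pure_def by blast
  then have "B - A \<noteq> {}" using assms(4) card_subset_eq[OF fin(1), of B] by auto
  then have "Max (B - A) < a" using assms(5) fin by simp
  then obtain b where b: "b \<in> B - A" "(A - {a}) \<union> {b} \<in> \<Delta>"
    using assms(1-4) unfolding QE_def by blast
  have "card (insert b (A - {a})) = card A"
    using b(1) assms(4) fin(1) card.remove[of A a] by auto
  then have "insert b (A - {a}) \<in> bases \<Delta>"
    using basis_if_card_eq[OF osc pure _ assms(2)] b(2) by simp
  with b(1) that show thesis by blast
qed

text \<open>Here \<open>C\<close> is a witness that \<open>b\<close> is internally passive in
  \<open>B\<close>. The induction varies \<open>A\<close> and keeps \<open>B\<close> fixed.\<close>

lemma QE_lex_smaller_neighbour: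
  assumes "QE E \<Delta>" "A \<in> bases \<Delta>" "B \<in> bases \<Delta>"
    and "sorted_list_of_set A < sorted_list_of_set B"
  shows "\<exists>b\<in>B - A. \<exists>C\<in>bases \<Delta>. B - {b} \<subseteq> C \<and> sorted_list_of_set C < sorted_list_of_set B"
  using assms
proof (induction "card (A - B)" arbitrary: A rule: less_induct)
  case less
  have osc: "ordered_simplicial_complex E \<Delta>" and pure: "pure \<Delta>"
    using less.prems(1) by (auto simp: QE_def)
  have fin: "finite C" if "C \<in> bases \<Delta>" for C
    using that ordered_simplicial_complex_finite_face[OF osc] by (auto simp: bases_def)
  have card: "card C = card B" if "C \<in> bases \<Delta>" for C
    using that less.prems(3) pure unfolding pure_def by blast
  note finAB = fin[OF less.prems(2)] fin[OF less.prems(3)]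
  obtain m where m: "m \<in> A - B" "\<And>x. x \<in> (A - B) \<union> (B - A) \<Longrightarrow> m \<le> x"
    using sorted_list_of_set_lessD[OF finAB card[OF less.prems(2)] less.prems(4)] by blast
  define M where "M = Max ((A - B) \<union> (B - A))"
  have D: "finite ((A - B) \<union> (B - A))" "(A - B) \<union> (B - A) \<noteq> {}"
    using m(1) finAB by auto
  have M: "M \<in> (A - B) \<union> (B - A)" "\<And>x. x \<in> (A - B) \<union> (B - A) \<Longrightarrow> x \<le> M"
    unfolding M_def using Max_in[OF D] Max_ge[OF D(1)] by blast+
  show ?case
  proof (cases "M \<in> B")
    case True
    have below: "x < M" if "x \<in> A - B" for x
    proof -
      have "x \<le> M" using that by (intro M(2)) blast
      moreover have "x \<noteq> M" using that True by blast
      ultimately show ?thesis by simp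
    qed
    have MB: "M \<in> B - A" using M(1) True by blast
    obtain a where a: "a \<in> A - B" "insert a (B - {M}) \<in> bases \<Delta>"
      using QE_exchange[OF less.prems(1,3,2) MB below] by blast
    \<comment> \<open>The two sets differ only in \<open>a\<close> and \<open>M\<close>, and
      \<open>a < M\<close>.\<close>
    have "sorted_list_of_set (insert a (B - {M})) < sorted_list_of_set B"
    proof (rule sorted_list_of_set_less[of _ _ a])
      show "a \<le> x" if "x \<in> insert a (B - {M}) - B \<union> (B - insert a (B - {M}))" for x
        using that below[OF a(1)] by auto
    qed (use a finAB card[OF a(2)] in auto)
    moreover have "B - {M} \<subseteq> insert a (B - {M})" by blast
    ultimately show ?thesis using a(2) MB by blast
  next
    case False
    have below: "x < M" if "x \<in> B - A" for x
    proof -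
      have "x \<le> M" using that by (intro M(2)) blast
      moreover have "x \<noteq> M" using that False by blast
      ultimately show ?thesis by simp
    qed
    have MA: "M \<in> A - B" using M(1) False by blast
    obtain b where b: "b \<in> B - A" "insert b (A - {M}) \<in> bases \<Delta>"
      using QE_exchange[OF less.prems(1,2,3) MA below] by blast
    let ?A = "insert b (A - {M})"
    \<comment> \<open>Since \<open>m \<le> b < M\<close>, removing \<open>M\<close> from
      \<open>A\<close> leaves \<open>m\<close> in place.\<close>
    have "m \<le> b" using b(1) by (intro m(2)) blast
    then have "m \<noteq> M" using below[OF b(1)] by simp
    have lt: "sorted_list_of_set ?A < sorted_list_of_set B"
    proof (rule sorted_list_of_set_less[of _ _ m])
      show "m \<in> ?A - B" using m(1) \<open>m \<noteq> M\<close> by blast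
      show "m \<le> x" if "x \<in> ?A - B \<union> (B - ?A)" for x
        using that b(1) MA by (intro m(2)) blast
    qed (use finAB card[OF b(2)] in auto)
    have "card (?A - B) < card (A - B)"
      using b(1) MA finAB by (intro psubset_card_mono) auto
    \<comment> \<open>The element obtained lies in \<open>B - ?A\<close>; as \<open>M\<close> is not
      in \<open>B\<close>, it also lies in \<open>B - A\<close>.\<close>
    from less.hyps[OF this less.prems(1) b(2) less.prems(3) lt]
    show ?thesis using MA by blast
  qed
qed

lemma mem_IP_iff:
  "b \<in> IP \<Delta> B \<longleftrightarrow>
    b \<in> B \<and> (\<exists>C\<in>bases \<Delta>. B - {b} \<subseteq> C \<and> sorted_list_of_set C < sorted_list_of_set B)"
  by (auto simp: IP_def internally_active_def lex_le_def not_le)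

text \<open>This makes "earlier in the list" and "lexicographically smaller" interchangeable; the
  converse direction follows by trichotomy of the indices.\<close>

lemma lex_order_bases_nth_less_iff:
  assumes "ordered_simplicial_complex E \<Delta>"
    and "i < length (lex_order_bases \<Delta>)" "j < length (lex_order_bases \<Delta>)"
  shows "sorted_list_of_set (lex_order_bases \<Delta> ! i) < sorted_list_of_set (lex_order_bases \<Delta> ! j)
    \<longleftrightarrow> i < j"
proof -
  let ?Bs = "lex_order_bases \<Delta>"
  have less: "sorted_list_of_set (?Bs ! k) < sorted_list_of_set (?Bs ! l)"
    if "k < l" "l < length ?Bs" for k l
  proof -
    have "lex_le (?Bs ! k) (?Bs ! l)" "?Bs ! k \<noteq> ?Bs ! l"
      using lex_order_bases_props(3)[OF assms(1)] that by (auto simp: sorted_wrt_iff_nth_less)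
    \<comment> \<open>\<open>sorted_list_of_set\<close> is \<open>[]\<close> on infinite sets, so
      finiteness is what lets distinct bases have distinct lists.\<close>
    moreover have "finite (?Bs ! k)" "finite (?Bs ! l)"
      using lex_order_bases_props(1)[OF assms(1)] that
        ordered_simplicial_complex_finite_face[OF assms(1)]
      by (metis (mono_tags, lifting) bases_def mem_Collect_eq nth_mem order_less_trans)+
    ultimately show ?thesis
      unfolding lex_le_def by (metis order_le_less set_sorted_list_of_set)
  qed
  show ?thesis
    using less[of i j] less[of j i] assms(2,3) by (metis less_asym linorder_neqE_nat less_irrefl)
qed

theorem theorem4p8:
  fixes E :: "'a::linorder set" and \<Delta> :: "'a set set"
  assumes "QE E \<Delta>"
  shows "shelling_order \<Delta> (lex_order_bases \<Delta>) \<and>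
    (\<forall>j<length (lex_order_bases \<Delta>).
       is_restriction_set (lex_order_bases \<Delta>) j (IP \<Delta> (lex_order_bases \<Delta> ! j)))"
proof -
  let ?Bs = "lex_order_bases \<Delta>"
  have osc: "ordered_simplicial_complex E \<Delta>" and pure: "pure \<Delta>"
    using assms by (auto simp: QE_def)
  note Bs = lex_order_bases_props(1,2)[OF osc]
  note less_iff = lex_order_bases_nth_less_iff[OF osc]
  have basis: "?Bs ! j \<in> bases \<Delta>" if "j < length ?Bs" for j
    using Bs(1) that nth_mem by blast
  \<comment> \<open>The index \<open>l\<close> serves as the shelling witness below. It also shows
    that a new face cannot avoid \<open>b\<close>, since otherwise it would lie in
    \<open>?Bs ! l\<close>.\<close>
  have passive_iff: "b \<in> IP \<Delta> (?Bs ! j) \<longleftrightarrow> b \<in> ?Bs ! j \<and> (\<exists>l<j. ?Bs ! j - {b} \<subseteq> ?Bs ! l)"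
    if j: "j < length ?Bs" for j b
  proof -
    have "(\<exists>C\<in>bases \<Delta>. ?Bs ! j - {b} \<subseteq> C \<and> sorted_list_of_set C < sorted_list_of_set (?Bs ! j))
      \<longleftrightarrow> (\<exists>l<length ?Bs. ?Bs ! j - {b} \<subseteq> ?Bs ! l \<and>
            sorted_list_of_set (?Bs ! l) < sorted_list_of_set (?Bs ! j))"
      unfolding Bs(1)[symmetric] by (metis in_set_conv_nth)
    also have "\<dots> \<longleftrightarrow> (\<exists>l<j. ?Bs ! j - {b} \<subseteq> ?Bs ! l)"
      using j less_iff by (meson order_less_trans)
    finally show ?thesis by (simp add: mem_IP_iff)
  qed
  have crux: "\<exists>b. b \<in> IP \<Delta> (?Bs ! j) \<and> b \<notin> ?Bs ! i"
    if "i < j" "j < length ?Bs" for i j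
    using QE_lex_smaller_neighbour[OF assms basis basis, of i j] less_iff[of i j] that
    by (auto simp: mem_IP_iff)
  have "\<exists>l<j. \<exists>b\<in>?Bs ! j. ?Bs ! i \<inter> ?Bs ! j \<subseteq> ?Bs ! l \<inter> ?Bs ! j \<and>
      ?Bs ! l \<inter> ?Bs ! j = ?Bs ! j - {b}"
    if ij: "i < j" "j < length ?Bs" for i j
  proof -
    obtain b where b: "b \<in> IP \<Delta> (?Bs ! j)" "b \<notin> ?Bs ! i"
      using crux[OF ij] by blast
    then obtain l where l: "l < j" "?Bs ! j - {b} \<subseteq> ?Bs ! l" "b \<in> ?Bs ! j"
      using passive_iff[OF ij(2)] by blast
    \<comment> \<open>Distinct bases are incomparable by maximality, so \<open>b\<close> is exactly
      what \<open>?Bs ! l\<close> misses.\<close>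
    have "\<not> ?Bs ! j \<subseteq> ?Bs ! l"
      using basis[of j] basis[of l] l(1) ij(2) Bs(2)
      by (auto simp: bases_def nth_eq_iff_index_eq)
    then have "?Bs ! l \<inter> ?Bs ! j = ?Bs ! j - {b}" using l by blast
    then show ?thesis using l b(2) by blast
  qed
  then have "shelling_order \<Delta> ?Bs"
    using Bs pure unfolding shelling_order_def by blast
  moreover have "is_restriction_set ?Bs j (IP \<Delta> (?Bs ! j))" if j: "j < length ?Bs" for j
  proof -
    have new: "IP \<Delta> (?Bs ! j) \<in> new_faces ?Bs j"
      using crux[OF _ j] unfolding new_faces_def by (auto simp: IP_def)
    have least: "IP \<Delta> (?Bs ! j) \<subseteq> S" if "S \<in> new_faces ?Bs j" for S
      using that passive_iff[OF j] unfolding new_faces_def by blast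
    \<comment> \<open>A least new face is the only minimal one.\<close>
    show ?thesis
      using new least unfolding is_restriction_set_def by blast
  qed
  ultimately show ?thesis by blast
qed

end
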